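(* Let $P$ be a $d$-polytope, let $\mathcal{C}_P$ be the $V(P)$-pointed triangulation of $P$, and for $0\le k\le d$ let $\mathcal{F}_k(\mathcal{C}_P,\mathbf{v}_P)$ be the set of $k$-simplexes $\alpha^k$ of $\mathcal{C}_P$ with $\mathbf{v}_P\in\alpha^k$. Then the $V(P)$-polytope numbers are represented, for all $n\ge0$, by $$P(n)=\sum_{k=0}^{d}c_k\,\alpha^k(n-k),\qquad\text{where } c_k=\big|\mathcal{F}_k(\mathcal{C}_P,\mathbf{v}_P)\big|.$$
   Context: A $d$-polytope is a $d$-dimensional convex hull of finitely many points in some $\mathbb{R}^e$. Pointed triangulation: let $\mathbf{c}\mathbf{x}$ be a linear function taking distinct values at distinct vertexes of $P$. For each nonempty face $F$ of $P$ (including $P$) let the apex $\mathbf{v}_F$ be the unique vertex of $F$ at which $\mathbf{c}\mathbf{x}$ attains its minimum on $F$; $V(P)$ denotes this system of apexes. The $V(P)$-pointed triangulation of $P$ is $$\mathcal{C}_P=\{\emptyset\}\cup\big\{conv(\{\mathbf{v}_{G_1},\ldots,\mathbf{v}_{G_k}\}) : 1\le k\le d+1,\ G_1\supsetneq\cdots\supsetneq G_k \text{ nonempty faces of } P,\ \mathbf{v}_{G_i}\notin G_{i+1}\ (1\le i<k)\big\},$$ which is a triangulation of $P$. Polytope numbers: let $\mathcal{F}(P)$ be the set of nonempty faces of $P$, including $P$. With the apexes above, the $V(P)$-polytope numbers $P(n)$ and interior polytope numbers $P(n)^\sharp$ are defined by double induction on $d=\dim P$ and $n\ge0$ (each face is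 a polytope with the inherited apexes): if $d=0$, $P(0)=P(0)^\sharp=0$ and $P(n)=P(n)^\sharp=1$ for $n\ge1$; if $d\ge1$, $P(0)=0$, $P(1)=1$, $P(0)^\sharp=P(1)^\sharp=0$, and for $n\ge2$ $$P(n)=P(n-1)+\sum_{F\in\mathcal{F}(P),\ \mathbf{v}_P\notin F}F(n)^\sharp,\qquad P(n)^\sharp=P(n)-\sum_{F\in\mathcal{F}(P)\setminus\{P\}}F(n)^\sharp .$$ $\alpha^k(m)$ denotes the polytope numbers of a $k$-simplex; explicitly $\alpha^k(m)=\binom{m+k-1}{k}$ for $m\ge1$ and $\alpha^k(m)=0$ for $m\le0$ (also for $k=0$). *)

theory Defs
  imports "HOL-Analysis.Analysis"
begin

definition separates_vertices :: "'a::euclidean_space \<Rightarrow> 'a set \<Rightarrow> bool" where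
  "separates_vertices c P \<longleftrightarrow> inj_on (\<lambda>x. c \<bullet> x) {v. v extreme_point_of P}"

definition apex :: "'a::euclidean_space \<Rightarrow> 'a set \<Rightarrow> 'a" where
  "apex c F = (THE v. v extreme_point_of F \<and> (\<forall>x\<in>F. c \<bullet> v \<le> c \<bullet> x))"

lemma separates_vertices_face:
  assumes "separates_vertices c P" "F face_of P"
  shows "separates_vertices c F"
  using assms by (auto simp: separates_vertices_def inj_on_def extreme_point_of_face)

lemma apex_unique_exists:
  assumes "polytope F" "F \<noteq> {}" "separates_vertices c F"
  shows "\<exists>!v. v extreme_point_of F \<and> (\<forall>x\<in>F. c \<bullet> v \<le> c \<bullet> x)"
proof -
  have cpt: "compact F" and cvx: "convex F"
    using assms(1) by (auto simp: polytope_imp_compact polytope_imp_convex)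
  obtain y where y: "y \<in> F" "\<And>x. x \<in> F \<Longrightarrow> c \<bullet> y \<le> c \<bullet> x"
    using continuous_attains_inf[OF cpt assms(2) continuous_on_inner[OF continuous_on_const continuous_on_id]]
    by blast
  let ?T = "F \<inter> {x. c \<bullet> x = c \<bullet> y}"
  have face: "?T face_of F"
    by (rule face_of_Int_supporting_hyperplane_ge) (use cvx y in auto)
  have "compact ?T" "convex ?T" "?T \<noteq> {}"
    using cpt cvx y(1) by (auto simp: compact_Int_closed closed_hyperplane convex_Int convex_hyperplane)
  then obtain v where v: "v extreme_point_of ?T"
    using extreme_point_exists_convex by blast
  then have "v extreme_point_of F" "c \<bullet> v = c \<bullet> y"
    using extreme_point_of_face[OF face] by auto
  show ?thesis
  proof (rule ex1I[of _ v])
    show "v extreme_point_of F \<and> (\<forall>x\<in>F. c \<bullet> v \<le> c \<bullet> x)"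
      using \<open>v extreme_point_of F\<close> \<open>c \<bullet> v = c \<bullet> y\<close> y(2) by auto
  next
    fix w assume w: "w extreme_point_of F \<and> (\<forall>x\<in>F. c \<bullet> w \<le> c \<bullet> x)"
    then have "c \<bullet> w = c \<bullet> v"
      using y \<open>c \<bullet> v = c \<bullet> y\<close> by (metis antisym extreme_point_of_def)
    then show "w = v"
      using assms(3) w \<open>v extreme_point_of F\<close> by (auto simp: separates_vertices_def inj_on_def)
  qed
qed

lemma apex_in:
  assumes "polytope F" "F \<noteq> {}" "separates_vertices c F"
  shows "apex c F \<in> F"
  using theI'[OF apex_unique_exists[OF assms]] by (auto simp: apex_def extreme_point_of_def)

definition pointed_triangulation :: "'a::euclidean_space \<Rightarrow> 'a set \<Rightarrow> 'a set set" where
  "pointed_triangulation c P =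
     {{}} \<union> {convex hull (apex c ` set Gs) | Gs.
        1 \<le> length Gs \<and> int (length Gs) \<le> aff_dim P + 1 \<and>
        (\<forall>G\<in>set Gs. G face_of P \<and> G \<noteq> {}) \<and>
        (\<forall>i. Suc i < length Gs \<longrightarrow> Gs ! Suc i \<subset> Gs ! i \<and> apex c (Gs ! i) \<notin> Gs ! Suc i)}"

text \<open>
  The double recursion on dimension and \<open>n\<close> is written for all sets, with junk value 0 unless \<open>P\<close>
  is a nonempty polytope on whose vertices \<open>c\<close> is injective. These conditions pass to nonempty
  faces, so the junk value is never reached from such a \<open>P\<close>.  Values are integers because
  \<open>interior_polytope_number\<close> is defined by a subtraction.
\<close>

function polytope_number :: "'a::euclidean_space \<Rightarrow> 'a set \<Rightarrow> nat \<Rightarrow> int"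
  and interior_polytope_number :: "'a::euclidean_space \<Rightarrow> 'a set \<Rightarrow> nat \<Rightarrow> int"
where
  "polytope_number c P n =
    (if polytope P \<and> P \<noteq> {} \<and> separates_vertices c P then
       if aff_dim P = 0 then (if n = 0 then 0 else 1)
       else if n = 0 then 0
       else if n = 1 then 1
       else polytope_number c P (n - 1)
            + (\<Sum>F\<in>{F. F face_of P \<and> F \<noteq> {} \<and> apex c P \<notin> F}. interior_polytope_number c F n)
     else 0)"
| "interior_polytope_number c P n =
    (if polytope P \<and> P \<noteq> {} \<and> separates_vertices c P then
       if aff_dim P = 0 then (if n = 0 then 0 else 1)
       else if n \<le> 1 then 0
       else polytope_number c P n
            - (\<Sum>F\<in>{F. F face_of P \<and> F \<noteq> {}} - {P}. interior_polytope_number c F n)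
     else 0)"
  by pat_completeness auto

lemma face_dim_less:
  fixes P :: "'a::euclidean_space set"
  assumes "polytope P" "F face_of P" "F \<noteq> P"
  shows "nat (aff_dim F + 1) < nat (aff_dim P + 1)"
  using face_of_aff_dim_lt[OF polytope_imp_convex[OF assms(1)] assms(2,3)] aff_dim_geq[of F]
  by linarith

termination
proof (relation "measures
    [\<lambda>x. case x of Inl (c, P, n) \<Rightarrow> nat (aff_dim P + 1) | Inr (c, P, n) \<Rightarrow> nat (aff_dim P + 1),
     \<lambda>x. case x of Inl (c, P, n) \<Rightarrow> n | Inr (c, P, n) \<Rightarrow> n,
     \<lambda>x. case x of Inl _ \<Rightarrow> 0 | Inr _ \<Rightarrow> 1]", goal_cases)
  case (3 c P n F)
  then have "F \<noteq> P" using apex_in by blast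
  then show ?case using 3 face_dim_less[of P F] by simp
next
  case (5 c P n F)
  then show ?case using face_dim_less[of P F] by simp
qed auto

declare polytope_number.simps [simp del] interior_polytope_number.simps [simp del]

definition simplex_number :: "nat \<Rightarrow> int \<Rightarrow> int" where
  "simplex_number k m = (if m \<le> 0 then 0 else int ((nat m + k - 1) choose k))"

text \<open>
  The pointed triangulation is a triangulation, so for one of its simplexes containing the apex of
  \<open>P\<close> is the same as having it as a vertex.
\<close>

definition apex_simplexes :: "'a::euclidean_space \<Rightarrow> 'a set \<Rightarrow> nat \<Rightarrow> 'a set set" where
  "apex_simplexes c P k = {T \<in> pointed_triangulation c P. int k simplex T \<and> apex c P \<in> T}"

end

theory Submission
  imports Defs
begin

text \<open>
  Write \<open>v\<close> for the apex of \<open>P\<close> and count a simplex by its vertex set \<open>S\<close>, the empty set included.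
  The triangulation is a cone with apex \<open>v\<close>, so \<open>S \<mapsto> insert v S\<close> matches the simplexes avoiding
  \<open>v\<close> with those containing it, and the claim reads
  \<open>P(n) = \<Sum>\<^bsub>v \<notin> S\<^esub> C(n - 1, |S|)\<close> for \<open>n \<ge> 1\<close>.
  By Pascal's rule the right-hand side is also \<open>\<Sum>\<^bsub>S \<noteq> \<emptyset>\<^esub> C(n - 2, |S| - 1)\<close> for \<open>n \<ge> 2\<close>.
  Sorting the simplexes by the smallest face containing them therefore shows, by induction on the
  dimension, that \<open>P(n)\<^sup>\<sharp>\<close> is the part of that sum over the simplexes not contained in a proper face.
  A face avoids \<open>v\<close> iff the simplexes spanning it avoid \<open>v\<close>, so
  \<open>P(n) - P(n - 1) = \<Sum>\<^bsub>S \<noteq> \<emptyset>, v \<notin> S\<^esub> C(n - 2, |S| - 1)\<close>, which is Pascal's rule again.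
\<close>

section \<open>Carrier faces and vertex sets of simplexes\<close>

text \<open>The empty face counts, so the carrier of \<open>{}\<close> is \<open>{}\<close>.\<close>

definition carrier_face :: "'a::euclidean_space set \<Rightarrow> 'a set \<Rightarrow> 'a set" where
  "carrier_face P S = \<Inter>{F. F face_of P \<and> S \<subseteq> F}"

text \<open>The vertex sets of the simplexes, built from the smallest face upwards. Asking only for
  some face \<open>H\<close> between the old vertices and \<open>G\<close>, not for a recorded
  chain, makes the condition stable under intersection with a face.\<close>

inductive apex_set :: "'a::euclidean_space \<Rightarrow> 'a set \<Rightarrow> 'a set \<Rightarrow> bool" for c P where
  empty: "apex_set c P {}"
| insert: "\<lbrakk>apex_set c P S; G face_of P; G \<noteq> {}; H face_of P; H \<subseteq> G; S \<subseteq> H; apex c G \<notin> H\<rbrakk>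
    \<Longrightarrow> apex_set c P (insert (apex c G) S)"

definition apex_sets :: "'a::euclidean_space \<Rightarrow> 'a set \<Rightarrow> 'a set set" where
  "apex_sets c P = {S. apex_set c P S}"

definition apex_chain :: "'a::euclidean_space \<Rightarrow> 'a set \<Rightarrow> 'a set list \<Rightarrow> bool" where
  "apex_chain c P Gs \<longleftrightarrow> (\<forall>G\<in>set Gs. G face_of P \<and> G \<noteq> {}) \<and>
     (\<forall>i. Suc i < length Gs \<longrightarrow> Gs ! Suc i \<subset> Gs ! i \<and> apex c (Gs ! i) \<notin> Gs ! Suc i)"

lemma apex_chain_Nil [simp]: "apex_chain c P []"
  by (simp add: apex_chain_def)

lemma apex_chain_Cons:
  "apex_chain c P (G # Gs) \<longleftrightarrow> G face_of P \<and> G \<noteq> {} \<and> apex_chain c P Gs \<and>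
     (Gs \<noteq> [] \<longrightarrow> hd Gs \<subset> G \<and> apex c G \<notin> hd Gs)"
proof (cases Gs)
  case Nil
  then show ?thesis by (simp add: apex_chain_def)
next
  case (Cons H Hs)
  have *: "(\<forall>i. Suc i < length (G # Gs) \<longrightarrow> Q ((G # Gs) ! i) ((G # Gs) ! Suc i)) \<longleftrightarrow>
      Q G (hd Gs) \<and> (\<forall>i. Suc i < length Gs \<longrightarrow> Q (Gs ! i) (Gs ! Suc i))" for Q
  proof (intro iffI conjI allI impI)
    fix i assume "Q G (hd Gs) \<and> (\<forall>i. Suc i < length Gs \<longrightarrow> Q (Gs ! i) (Gs ! Suc i))"
      and "Suc i < length (G # Gs)"
    then show "Q ((G # Gs) ! i) ((G # Gs) ! Suc i)"
      using Cons by (cases i) auto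
  qed (use Cons in auto)
  show ?thesis
    unfolding apex_chain_def *[of "\<lambda>A B. B \<subset> A \<and> apex c A \<notin> B"] using Cons by auto
qed

lemma carrier_face_face_of:
  assumes "convex P" "S \<subseteq> P"
  shows "carrier_face P S face_of P"
  unfolding carrier_face_def using assms face_of_refl[of P]
  by (intro face_of_Inter) auto

lemma carrier_face_least: "F face_of P \<Longrightarrow> S \<subseteq> F \<Longrightarrow> carrier_face P S \<subseteq> F"
  by (auto simp: carrier_face_def)

lemma subset_carrier_face: "S \<subseteq> carrier_face P S"
  by (auto simp: carrier_face_def)

text \<open>Faces of \<open>F\<close> are faces of \<open>P\<close>, and every face of
  \<open>P\<close> cuts \<open>F\<close> in a face of \<open>F\<close>.\<close>

lemma carrier_face_of_face:
  assumes "F face_of P" "S \<subseteq> F"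
  shows "carrier_face F S = carrier_face P S"
proof
  show "carrier_face F S \<subseteq> carrier_face P S"
    unfolding carrier_face_def
  proof (rule Inter_greatest, safe)
    fix x K assume *: "x \<in> \<Inter>{K. K face_of F \<and> S \<subseteq> K}" "K face_of P" "S \<subseteq> K"
    then have "F \<inter> K face_of F"
      by (meson assms(1) face_of_Int face_of_imp_subset face_of_subset inf_le1)
    then show "x \<in> K" using * assms by auto
  qed
  show "carrier_face P S \<subseteq> carrier_face F S"
    unfolding carrier_face_def using assms face_of_trans by blast
qed

section \<open>Apexes of faces\<close>

locale pointed_polytope =
  fixes c :: "'a::euclidean_space" and P :: "'a set"
  assumes polytope: "polytope P" and separates: "separates_vertices c P"
begin

lemma face: "F face_of P \<Longrightarrow> pointed_polytope c F"
  by (meson face_of_polytope_polytope pointed_polytope_def polytope separates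
      separates_vertices_face)

lemma convex: "convex P"
  using polytope by (rule polytope_imp_convex)

lemma apex_extreme:
  assumes "P \<noteq> {}" shows "apex c P extreme_point_of P"
  using theI'[OF apex_unique_exists[OF polytope assms separates]] by (simp add: apex_def)

lemma apex_le:
  assumes "x \<in> P" shows "c \<bullet> apex c P \<le> c \<bullet> x"
proof -
  have "P \<noteq> {}" using assms by auto
  then show ?thesis
    using theI'[OF apex_unique_exists[OF polytope _ separates]] assms by (simp add: apex_def)
qed

lemma apex_mem: "P \<noteq> {} \<Longrightarrow> apex c P \<in> P"
  using apex_in polytope separates by blast

lemma apex_eqI:
  assumes "v extreme_point_of P" "\<And>x. x \<in> P \<Longrightarrow> c \<bullet> v \<le> c \<bullet> x"
  shows "apex c P = v"
proof -
  have "P \<noteq> {}" using assms(1) by (auto simp: extreme_point_of_def)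
  then show ?thesis
    unfolding apex_def using apex_unique_exists[OF polytope _ separates] assms
    by (intro the1_equality) auto
qed

lemma apex_face_eq:
  assumes "F face_of P" "apex c P \<in> F"
  shows "apex c F = apex c P"
proof -
  interpret F: pointed_polytope c F using assms(1) by (rule face)
  have sub: "F \<subseteq> P" using assms(1) by (rule face_of_imp_subset)
  show ?thesis
  proof (rule F.apex_eqI)
    show "apex c P extreme_point_of F"
      using apex_extreme assms sub by (auto simp: extreme_point_of_face)
  qed (use apex_le sub in auto)
qed

text \<open>The minimum over \<open>G\<close> is attained in the face \<open>G \<inter> K\<close>.
  Thus the faces of a construction can be cut down to a given face without moving their
  apexes.\<close>

lemma apex_face_Int:
  assumes "G face_of P" "K face_of P" "apex c G \<in> K"
  shows "apex c (G \<inter> K) = apex c G"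
proof (cases "G = {}")
  case False
  interpret G: pointed_polytope c G using assms(1) by (rule face)
  have "G \<inter> K face_of G"
    by (meson assms face_of_Int face_of_imp_subset face_of_subset inf_le1)
  then show ?thesis using False assms(3) G.apex_mem by (intro G.apex_face_eq) auto
qed simp

section \<open>Vertex sets: restriction to faces, cone structure, affine independence\<close>

lemma apex_set_subset_extreme: "apex_set c P S \<Longrightarrow> S \<subseteq> {x. x extreme_point_of P}"
proof (induction rule: apex_set.induct)
  case (insert S G H)
  have "apex c G extreme_point_of G"
    using insert face pointed_polytope.apex_extreme by blast
  then show ?case using insert extreme_point_of_face by blast
qed simp

lemma apex_set_subset: "apex_set c P S \<Longrightarrow> S \<subseteq> P"
  using apex_set_subset_extreme by (auto simp: extreme_point_of_def)

lemma finite_apex_sets: "finite (apex_sets c P)"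
proof (rule finite_subset)
  show "apex_sets c P \<subseteq> Pow {x. x extreme_point_of P}"
    using apex_set_subset_extreme by (auto simp: apex_sets_def)
  show "finite (Pow {x. x extreme_point_of P})"
    using polytope finite_polyhedron_extreme_points polytope_imp_polyhedron by auto
qed

lemma apex_set_finite: "apex_set c P S \<Longrightarrow> finite S"
  by (induction rule: apex_set.induct) auto

lemma apex_set_mono:
  assumes "F face_of P" "apex_set c F S"
  shows "apex_set c P S"
  using assms(2)
proof (induction rule: apex_set.induct)
  case (insert S G H)
  then have "G face_of P" "H face_of P"
    using assms(1) face_of_trans by blast+
  with insert show ?case by (intro apex_set.insert)
qed (rule apex_set.empty)

text \<open>Cut every \<open>G\<close> and \<open>H\<close> of the construction with
  \<open>F\<close>: the apexes lie in \<open>S\<close>, hence in \<open>F\<close>, and stay the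
  same.\<close>

lemma apex_set_restrict:
  assumes "apex_set c P S" "F face_of P" "S \<subseteq> F"
  shows "apex_set c F S"
  using assms
proof (induction rule: apex_set.induct)
  case (insert S G H)
  have *: "K \<inter> F face_of F" if "K face_of P" for K
    by (meson that insert.prems(1) face_of_Int face_of_imp_subset face_of_subset inf_le2)
  have ap: "apex c (G \<inter> F) = apex c G"
    using insert apex_face_Int by blast
  have "apex c G \<in> G"
    using insert face pointed_polytope.apex_mem by blast
  then have "apex_set c F (insert (apex c (G \<inter> F)) S)"
    using insert * ap by (intro apex_set.insert[where H = "H \<inter> F"]) auto
  then show ?case using ap by simp
qed (rule apex_set.empty)

lemma apex_sets_face:
  assumes "F face_of P"
  shows "apex_sets c F = {S \<in> apex_sets c P. S \<subseteq> F}"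
  using apex_set_restrict[OF _ assms] apex_set_mono[OF assms]
    pointed_polytope.apex_set_subset[OF face[OF assms]]
  unfolding apex_sets_def by blast

text \<open>For nonempty \<open>S\<close> the vertex added last is the apex of a face
  \<open>G\<close> that contains \<open>S\<close>, hence also the carrier. If the carrier contains
  the apex of \<open>P\<close>, so does \<open>G\<close>, and the two apexes coincide.\<close>

lemma apex_in_carrier_face_iff:
  assumes "apex_set c P S" "P \<noteq> {}"
  shows "apex c P \<in> carrier_face P S \<longleftrightarrow> apex c P \<in> S"
proof
  assume v: "apex c P \<in> carrier_face P S"
  from assms(1) show "apex c P \<in> S"
  proof cases
    case empty
    then show ?thesis using v carrier_face_least[of "{}" P "{}"] by auto
  next
    case (insert S' G H)
    have "apex c G \<in> G"
      using insert face pointed_polytope.apex_mem by blast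
    then have "apex c P \<in> G"
      using v insert carrier_face_least[of G P S] by blast
    then have "apex c G = apex c P" using apex_face_eq[OF \<open>G face_of P\<close>] by simp
    then show ?thesis using insert(1) by auto
  qed
qed (use subset_carrier_face in blast)

text \<open>Take \<open>P\<close> for \<open>G\<close> and the carrier of \<open>S\<close> for
  \<open>H\<close>; the carrier avoids the apex because \<open>S\<close> does.\<close>

lemma apex_set_insert_apex:
  assumes "apex_set c P S" "P \<noteq> {}" "apex c P \<notin> S"
  shows "apex_set c P (insert (apex c P) S)"
proof (rule apex_set.insert)
  show face: "carrier_face P S face_of P"
    by (intro carrier_face_face_of convex apex_set_subset assms)
  show "carrier_face P S \<subseteq> P"
    using face by (rule face_of_imp_subset)
  show "apex c P \<notin> carrier_face P S"
    using assms apex_in_carrier_face_iff by simp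
qed (fact assms subset_carrier_face face_of_refl[OF convex])+

text \<open>The face \<open>G\<close> of the last step contains \<open>S\<close>, so the apex of
  \<open>P\<close> is the apex of \<open>G\<close>, and removing it undoes that step.\<close>

lemma apex_set_remove_apex:
  assumes "apex_set c P S" "apex c P \<in> S"
  shows "apex_set c P (S - {apex c P})"
  using assms(1)
proof cases
  case (insert S' G H)
  have "apex c G \<in> G"
    using insert face pointed_polytope.apex_mem by blast
  then have "S \<subseteq> G" using insert by auto
  then have "apex c G = apex c P"
    using assms(2) by (intro apex_face_eq[OF \<open>G face_of P\<close>]) auto
  then have "S - {apex c P} = S'" using insert by auto
  then show ?thesis using insert by simp
qed (use assms in simp)

text \<open>A face is the part of \<open>P\<close> in its own affine hull. The new apex lies in
  \<open>P\<close> but not in \<open>H\<close>, hence outside the affine hull of \<open>H\<close>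
  and of \<open>S\<close>.\<close>

lemma apex_set_affine_independent: "apex_set c P S \<Longrightarrow> \<not> affine_dependent S"
proof (induction rule: apex_set.induct)
  case (insert S G H)
  have "apex c G \<in> P"
    using insert face pointed_polytope.apex_mem face_of_imp_subset by blast
  moreover have "H = affine hull H \<inter> P"
    using insert convex face_of_imp_eq_affine_Int by blast
  ultimately have "apex c G \<notin> affine hull H"
    using insert by blast
  then have "apex c G \<notin> affine hull S"
    using insert hull_mono[of S H affine] by blast
  then show ?case using insert affine_independent_insert by blast
qed simp

lemma apex_set_card_le:
  assumes "apex_set c P S" shows "int (card S) \<le> aff_dim P + 1"
  using aff_dim_affine_independent[OF apex_set_affine_independent[OF assms]]
    aff_dim_subset[OF apex_set_subset[OF assms]] by linarith

section \<open>Binomial sums over cones and over carriers\<close>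

lemma bij_betw_insert_apex:
  assumes "P \<noteq> {}"
  shows "bij_betw (insert (apex c P)) {S \<in> apex_sets c P. apex c P \<notin> S}
    {S \<in> apex_sets c P. apex c P \<in> S}"
  by (rule bij_betw_byWitness[where f' = "\<lambda>S. S - {apex c P}"])
    (use assms apex_set_insert_apex apex_set_remove_apex in \<open>auto simp: apex_sets_def\<close>)

lemma sum_apex_sets_cone:
  fixes f :: "nat \<Rightarrow> 'b::comm_monoid_add"
  assumes "P \<noteq> {}"
  shows "(\<Sum>S | S \<in> apex_sets c P \<and> apex c P \<in> S. f (card S)) =
    (\<Sum>S | S \<in> apex_sets c P \<and> apex c P \<notin> S. f (Suc (card S)))"
proof -
  have "(\<Sum>S | S \<in> apex_sets c P \<and> apex c P \<in> S. f (card S)) =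
      (\<Sum>S | S \<in> apex_sets c P \<and> apex c P \<notin> S. f (card (insert (apex c P) S)))"
    by (rule sum.reindex_bij_betw[symmetric, OF bij_betw_insert_apex[OF assms]])
  also have "\<dots> = (\<Sum>S | S \<in> apex_sets c P \<and> apex c P \<notin> S. f (Suc (card S)))"
    by (intro sum.cong) (auto simp: apex_sets_def apex_set_finite)
  finally show ?thesis .
qed

lemma sum_apex_sets_Pascal:
  assumes "P \<noteq> {}"
  shows "(\<Sum>S\<in>apex_sets c P - {{}}. int (n choose (card S - 1))) =
    (\<Sum>S | S \<in> apex_sets c P \<and> apex c P \<notin> S. int (Suc n choose card S))"
proof -
  let ?A = "{S \<in> apex_sets c P. apex c P \<in> S}" and ?B = "{S \<in> apex_sets c P. apex c P \<notin> S}"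
  have fin: "finite ?A" "finite ?B" using finite_apex_sets by auto
  have mt: "{} \<in> ?B" by (auto simp: apex_sets_def apex_set.empty)
  have eq: "apex_sets c P - {{}} = ?A \<union> (?B - {{}})"
    by auto
  have "(\<Sum>S\<in>apex_sets c P - {{}}. int (n choose (card S - 1))) =
      (\<Sum>S\<in>?A. int (n choose (card S - 1))) + (\<Sum>S\<in>?B - {{}}. int (n choose (card S - 1)))"
    unfolding eq using fin by (intro sum.union_disjoint) auto
  also have "(\<Sum>S\<in>?A. int (n choose (card S - 1))) = (\<Sum>S\<in>?B. int (n choose card S))"
    using sum_apex_sets_cone[OF assms, of "\<lambda>k. int (n choose (k - 1))"] by simp
  \<comment> \<open>The empty set is kept apart: its cone already gives C(n, 0) = C(n + 1, 0) = 1,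
    and truncated subtraction breaks Pascal's rule at cardinality 0.\<close>
  also have "\<dots> = 1 + (\<Sum>S\<in>?B - {{}}. int (n choose card S))"
    using sum.remove[OF fin(2) mt, of "\<lambda>S. int (n choose card S)"] by simp
  also have "1 + (\<Sum>S\<in>?B - {{}}. int (n choose card S)) +
        (\<Sum>S\<in>?B - {{}}. int (n choose (card S - 1))) =
      1 + (\<Sum>S\<in>?B - {{}}. int (Suc n choose card S))"
  proof -
    have "int (n choose card S) + int (n choose (card S - 1)) = int (Suc n choose card S)"
      if "S \<in> ?B - {{}}" for S
    proof -
      have "card S \<noteq> 0" using that apex_set_finite by (auto simp: apex_sets_def)
      then show ?thesis by (cases "card S") auto
    qed
    then show ?thesis by (simp add: sum.distrib[symmetric])
  qed
  also have "\<dots> = (\<Sum>S\<in>?B. int (Suc n choose card S))"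
    using sum.remove[OF fin(2) mt, of "\<lambda>S. int (Suc n choose card S)"] by simp
  finally show ?thesis .
qed

text \<open>Every nonempty vertex set has exactly one carrier, a nonempty face; \<open>{}\<close>
  drops out with the empty face. \<open>Q\<close> will select all faces or those avoiding the
  apex.\<close>

lemma sum_over_faces_carrier:
  fixes f :: "'a set \<Rightarrow> 'b::comm_monoid_add"
  shows "(\<Sum>F | F face_of P \<and> F \<noteq> {} \<and> Q F.
      \<Sum>S | S \<in> apex_sets c P \<and> carrier_face P S = F. f S) =
    (\<Sum>S | S \<in> apex_sets c P - {{}} \<and> Q (carrier_face P S). f S)"
proof -
  have c: "carrier_face P S face_of P" "S \<noteq> {} \<Longrightarrow> carrier_face P S \<noteq> {}"
    if "S \<in> apex_sets c P" for S
    using that carrier_face_face_of convex apex_set_subset subset_carrier_face[of S P]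
    by (auto simp: apex_sets_def)
  have e: "carrier_face P {} = {}"
    using carrier_face_least[of "{}" P "{}"] by auto
  have "(\<Sum>S | S \<in> apex_sets c P - {{}} \<and> Q (carrier_face P S). f S) =
      (\<Sum>F | F face_of P \<and> F \<noteq> {} \<and> Q F.
        \<Sum>S | S \<in> {S. S \<in> apex_sets c P - {{}} \<and> Q (carrier_face P S)} \<and> carrier_face P S = F. f S)"
    by (rule sum.group[symmetric])
      (use finite_apex_sets finite_polytope_faces[OF polytope] c in auto)
  also have "\<dots> = (\<Sum>F | F face_of P \<and> F \<noteq> {} \<and> Q F.
      \<Sum>S | S \<in> apex_sets c P \<and> carrier_face P S = F. f S)"
    by (intro sum.cong refl) (use e in auto)
  finally show ?thesis by simp
qed

end

section \<open>Induction on the dimension\<close>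

text \<open>Interior numbers of proper faces yield the polytope numbers of \<open>P\<close>, which
  in turn yield its interior numbers. The shifts leave out the zero values at 0 and the interior
  value at 1, which depends on whether the dimension is 0.\<close>

lemma polytope_numbers_eq_apex_sets_sums:
  assumes "pointed_polytope c P" "P \<noteq> {}"
  shows "polytope_number c P (Suc n) =
      (\<Sum>S | S \<in> apex_sets c P \<and> apex c P \<notin> S. int (n choose card S)) \<and>
    interior_polytope_number c P (Suc (Suc n)) =
      (\<Sum>S | S \<in> apex_sets c P \<and> carrier_face P S = P. int (n choose (card S - 1)))"
  using assms
proof (induction "nat (aff_dim P + 1)" arbitrary: P n rule: less_induct)
  case less
  interpret pointed_polytope c P by (rule less.prems)
  note P = polytope separates \<open>P \<noteq> {}\<close>
  have refl: "P face_of P" using convex by (rule face_of_refl)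
  \<comment> \<open>Vertex sets of \<open>F\<close> are restated as vertex sets of \<open>P\<close>
    with carrier \<open>F\<close>, so that sums over faces merge into one sum.\<close>
  have interior_face: "interior_polytope_number c F (Suc (Suc m)) =
      (\<Sum>S | S \<in> apex_sets c P \<and> carrier_face P S = F. int (m choose (card S - 1)))"
    if F: "F face_of P" "F \<noteq> {}" "F \<noteq> P" for F m
  proof -
    have "S \<in> apex_sets c F \<and> carrier_face F S = F \<longleftrightarrow>
        S \<in> apex_sets c P \<and> carrier_face P S = F" for S
      using apex_sets_face[OF F(1)] carrier_face_of_face[OF F(1), of S] subset_carrier_face[of S]
      by (cases "S \<subseteq> F") auto
    then show ?thesis
      using less.hyps[OF face_dim_less[OF polytope F(1,3)] face[OF F(1)] F(2), of m] by simp
  qed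
  have number: "polytope_number c P (Suc n) =
      (\<Sum>S | S \<in> apex_sets c P \<and> apex c P \<notin> S. int (n choose card S))" for n
  proof (cases "aff_dim P = 0")
    case True
    then obtain a where a: "P = {a}" using aff_dim_eq_0 by blast
    then have v: "apex c P = a" using apex_mem by auto
    have "apex_set c P S \<and> a \<notin> S \<longleftrightarrow> S = {}" for S
      using apex_set_subset[of S] apex_set.empty[of c P] a by blast
    then have "{S \<in> apex_sets c P. apex c P \<notin> S} = {{}}"
      by (simp add: apex_sets_def v)
    then show ?thesis using P True by (subst polytope_number.simps) simp
  next
    case False
    let ?B = "{S \<in> apex_sets c P. apex c P \<notin> S}"
    have fin: "finite ?B" using finite_apex_sets by auto
    have mt: "{} \<in> ?B" by (auto simp: apex_sets_def apex_set.empty)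
    show ?thesis
    proof (induction n)
      case 0
      have "(0 choose card S) = 0" if "S \<in> ?B - {{}}" for S
        using that apex_set_finite by (auto simp: apex_sets_def card_gt_0_iff intro!: binomial_eq_0)
      then have "(\<Sum>S\<in>?B - {{}}. int (0 choose card S)) = 0"
        by (intro sum.neutral) simp
      then show ?case
        using P False sum.remove[OF fin mt, of "\<lambda>S. int (0 choose card S)"]
        by (subst polytope_number.simps) simp
    next
      case (Suc n)
      have "(\<Sum>F | F face_of P \<and> F \<noteq> {} \<and> apex c P \<notin> F. interior_polytope_number c F (Suc (Suc n)))
          = (\<Sum>F | F face_of P \<and> F \<noteq> {} \<and> apex c P \<notin> F.
            \<Sum>S | S \<in> apex_sets c P \<and> carrier_face P S = F. int (n choose (card S - 1)))"
        using interior_face apex_mem by (intro sum.cong) auto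
      also have "\<dots> = (\<Sum>S | S \<in> apex_sets c P - {{}} \<and> apex c P \<notin> carrier_face P S.
          int (n choose (card S - 1)))"
        by (rule sum_over_faces_carrier)
      also have "\<dots> = (\<Sum>S\<in>?B - {{}}. int (n choose (card S - 1)))"
        using apex_in_carrier_face_iff P by (intro sum.cong) (auto simp: apex_sets_def)
      also have "\<dots> = (\<Sum>S\<in>?B - {{}}. int (Suc n choose card S) - int (n choose card S))"
      proof (rule sum.cong)
        fix S assume "S \<in> ?B - {{}}"
        then have "card S \<noteq> 0" using apex_set_finite by (auto simp: apex_sets_def)
        then show "int (n choose (card S - 1)) = int (Suc n choose card S) - int (n choose card S)"
          by (cases "card S") auto
      qed simp
      \<comment> \<open>Restoring \<open>{}\<close> costs nothing: its difference is 1 - 1.\<close>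
      also have "\<dots> = (\<Sum>S\<in>?B. int (Suc n choose card S) - int (n choose card S))"
        using sum.remove[OF fin mt, of "\<lambda>S. int (Suc n choose card S) - int (n choose card S)"]
        by simp
      also have "\<dots> = (\<Sum>S\<in>?B. int (Suc n choose card S)) - polytope_number c P (Suc n)"
        unfolding Suc.IH by (rule sum_subtractf)
      finally show ?case
        using P False by (subst polytope_number.simps) simp
    qed
  qed
  have "interior_polytope_number c P (Suc (Suc n)) =
      (\<Sum>S | S \<in> apex_sets c P \<and> carrier_face P S = P. int (n choose (card S - 1)))"
  proof (cases "aff_dim P = 0")
    case True
    then obtain a where a: "P = {a}" using aff_dim_eq_0 by blast
    have e: "carrier_face P {} = {}"
      using carrier_face_least[of "{}" P "{}"] by auto
    have "carrier_face P P = P"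
      using refl carrier_face_least subset_carrier_face by blast
    moreover have "apex_set c P P"
      using apex_set_insert_apex[OF apex_set.empty] a apex_mem by auto
    ultimately have "apex_set c P S \<and> carrier_face P S = P \<longleftrightarrow> S = P" for S
      using apex_set_subset[of S] e a by (cases "S = {}") auto
    then have "{S \<in> apex_sets c P. carrier_face P S = P} = {P}"
      by (simp add: apex_sets_def)
    then show ?thesis using P True by (subst interior_polytope_number.simps) (simp add: a)
  next
    case False
    let ?I = "\<lambda>F. \<Sum>S | S \<in> apex_sets c P \<and> carrier_face P S = F. int (n choose (card S - 1))"
    let ?faces = "{F. F face_of P \<and> F \<noteq> {}}"
    \<comment> \<open>Once the nonempty sets are grouped by carrier, the recursion subtracts exactly
      the proper faces and leaves the term of \<open>P\<close>.\<close>
    have "polytope_number c P (Suc (Suc n)) =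
        (\<Sum>S\<in>apex_sets c P - {{}}. int (n choose (card S - 1)))"
      using number sum_apex_sets_Pascal P by simp
    also have "\<dots> = (\<Sum>F\<in>?faces. ?I F)"
      using sum_over_faces_carrier[where Q = "\<lambda>_. True" and f = "\<lambda>S. int (n choose (card S - 1))"]
      by (simp add: set_diff_eq)
    also have "\<dots> = ?I P + (\<Sum>F\<in>?faces - {P}. ?I F)"
      using refl P finite_polytope_faces[OF polytope] by (intro sum.remove) auto
    also have "(\<Sum>F\<in>?faces - {P}. ?I F) =
        (\<Sum>F\<in>?faces - {P}. interior_polytope_number c F (Suc (Suc n)))"
      using interior_face by (intro sum.cong) auto
    finally show ?thesis
      using P False by (subst interior_polytope_number.simps) simp
  qed
  with number show ?case by blast
qed

section \<open>Vertex sets and the simplexes of the triangulation\<close>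

context pointed_polytope
begin

text \<open>The next face of the chain, or the empty face at its end, serves as \<open>H\<close>: it
  contains all later apexes but not the present one. So the apexes are pairwise distinct.\<close>

lemma apex_chain_imp_apex_set:
  "apex_chain c P Gs \<Longrightarrow> apex_set c P (apex c ` set Gs) \<and> card (apex c ` set Gs) = length Gs \<and>
    (Gs \<noteq> [] \<longrightarrow> apex c ` set Gs \<subseteq> hd Gs)"
proof (induction Gs)
  case Nil
  then show ?case by (simp add: apex_set.empty)
next
  case (Cons G Gs)
  define H where "H = (if Gs = [] then {} else hd Gs)"
  have G: "G face_of P" "G \<noteq> {}" and IH: "apex_set c P (apex c ` set Gs)"
      "card (apex c ` set Gs) = length Gs" "apex c ` set Gs \<subseteq> H"
      and H: "H face_of P" "H \<subseteq> G" "apex c G \<notin> H"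
    using Cons by (auto simp: apex_chain_Cons H_def) (auto simp: apex_chain_def)
  have "apex c G \<in> G" using G face pointed_polytope.apex_mem by blast
  moreover have "apex c G \<notin> apex c ` set Gs" using IH H by blast
  ultimately show ?case
    using apex_set.insert[OF IH(1) G H(1,2) IH(3) H(3)] IH H by (auto simp: card_insert_if)
qed

text \<open>The bound \<open>K\<close> carries the induction: the chain for the smaller set is
  requested inside \<open>H \<inter> K\<close>, so its faces lie in \<open>G\<close> and miss the
  apex of \<open>G\<close>, and \<open>G \<inter> K\<close> can be put in front.\<close>

lemma apex_set_imp_apex_chain:
  assumes "apex_set c P S" "K face_of P" "S \<subseteq> K"
  obtains Gs where "apex_chain c P Gs" "S = apex c ` set Gs" "\<And>G. G \<in> set Gs \<Longrightarrow> G \<subseteq> K"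
proof -
  have "\<exists>Gs. apex_chain c P Gs \<and> S = apex c ` set Gs \<and> (\<forall>G\<in>set Gs. G \<subseteq> K)"
    using assms
  proof (induction arbitrary: K rule: apex_set.induct)
    case empty
    then show ?case by (intro exI[of _ "[]"]) simp
  next
    case (insert S G H)
    have HK: "H \<inter> K face_of P" "S \<subseteq> H \<inter> K"
      using insert.hyps insert.prems by (simp_all add: face_of_Int)
    obtain Gs where Gs: "apex_chain c P Gs" "S = apex c ` set Gs" "\<forall>G\<in>set Gs. G \<subseteq> H \<inter> K"
      using insert.IH[OF HK] by blast
    have K: "apex c G \<in> K" using insert.prems by simp
    have GK: "G \<inter> K face_of P"
      using insert.hyps insert.prems by (simp add: face_of_Int)
    have ap: "apex c (G \<inter> K) = apex c G"
      using insert.hyps insert.prems K by (intro apex_face_Int)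
    have mem: "apex c G \<in> G \<inter> K"
      using pointed_polytope.apex_mem[OF face[OF \<open>G face_of P\<close>] \<open>G \<noteq> {}\<close>] K by simp
    have sub: "hd Gs \<subseteq> H \<inter> K" if "Gs \<noteq> []" using Gs that by auto
    \<comment> \<open>The inclusion is strict because the apex of \<open>G\<close> lies in
      \<open>G \<inter> K\<close> but not in \<open>H\<close>.\<close>
    have "apex_chain c P ((G \<inter> K) # Gs)"
      unfolding apex_chain_Cons ap using Gs(1) GK mem sub \<open>H \<subseteq> G\<close> \<open>apex c G \<notin> H\<close> by blast
    then show ?case
      using Gs(2,3) ap \<open>H \<subseteq> G\<close> by (intro exI[of _ "(G \<inter> K) # Gs"]) auto
  qed
  then show ?thesis using that by blast
qed

lemma pointed_triangulation_eq: "pointed_triangulation c P = (hull) convex ` apex_sets c P"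
proof
  show "pointed_triangulation c P \<subseteq> (hull) convex ` apex_sets c P"
  proof
    fix T assume "T \<in> pointed_triangulation c P"
    then consider "T = {}" | Gs where "T = convex hull (apex c ` set Gs)" "apex_chain c P Gs"
      unfolding pointed_triangulation_def apex_chain_def by blast
    then show "T \<in> (hull) convex ` apex_sets c P"
    proof cases
      case 1
      then show ?thesis
        using apex_set.empty by (intro image_eqI[where x = "{}"]) (auto simp: apex_sets_def)
    qed (use apex_chain_imp_apex_set in \<open>auto simp: apex_sets_def\<close>)
  qed
  show "(hull) convex ` apex_sets c P \<subseteq> pointed_triangulation c P"
  proof clarify
    fix S assume "S \<in> apex_sets c P"
    then have S: "apex_set c P S" by (simp add: apex_sets_def)
    show "convex hull S \<in> pointed_triangulation c P"
    proof (cases "S = {}")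
      case False
      obtain Gs where Gs: "apex_chain c P Gs" "S = apex c ` set Gs"
        using apex_set_imp_apex_chain[OF S face_of_refl[OF convex] apex_set_subset[OF S]] .
      then have "1 \<le> length Gs" using False by (cases Gs) auto
      moreover have "int (length Gs) \<le> aff_dim P + 1"
        using apex_set_card_le[OF S] apex_chain_imp_apex_set Gs by auto
      ultimately show ?thesis
        using Gs unfolding pointed_triangulation_def apex_chain_def
        by (intro UnI2 CollectI exI[of _ Gs]) simp
    qed (simp add: pointed_triangulation_def)
  qed
qed

text \<open>An affinely independent set is recovered as the extreme points of its hull, so counting
  simplexes amounts to counting vertex sets.\<close>

lemma inj_on_convex_hull_apex_sets: "inj_on ((hull) convex) (apex_sets c P)"
proof (rule inj_onI)
  fix S T assume mem: "S \<in> apex_sets c P" "T \<in> apex_sets c P"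
    and hull: "convex hull S = convex hull T"
  have S: "\<not> affine_dependent S" and T: "\<not> affine_dependent T"
    using mem apex_set_affine_independent unfolding apex_sets_def by blast+
  have "x \<in> S \<longleftrightarrow> x \<in> T" for x
    using extreme_point_of_convex_hull_affine_independent[OF S, of x]
      extreme_point_of_convex_hull_affine_independent[OF T, of x] by (simp only: hull)
  then show "S = T" by (rule set_eqI)
qed

lemma apex_simplexes_eq:
  assumes "P \<noteq> {}"
  shows "apex_simplexes c P k = (hull) convex ` {S \<in> apex_sets c P. apex c P \<in> S \<and> card S = Suc k}"
proof -
  have simplex: "int k simplex (convex hull S) \<longleftrightarrow> card S = Suc k" if "S \<in> apex_sets c P" for S
  proof -
    have S: "\<not> affine_dependent S"
      using that apex_set_affine_independent by (simp add: apex_sets_def)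
    then have dim: "aff_dim (convex hull S) = int (card S) - 1"
      using aff_dim_affine_independent[OF S] by (simp add: aff_dim_convex_hull)
    show ?thesis
    proof
      assume "int k simplex (convex hull S)"
      then show "card S = Suc k" using aff_dim_simplex dim by fastforce
    next
      assume "card S = Suc k"
      then show "int k simplex (convex hull S)"
        using S unfolding simplex by (intro exI[of _ S]) (simp add: aff_independent_finite)
    qed
  qed
  \<comment> \<open>An extreme point of \<open>P\<close> lying in a hull inside \<open>P\<close> is
    extreme there too, hence one of the generating points.\<close>
  have mem: "apex c P \<in> convex hull S \<longleftrightarrow> apex c P \<in> S" if "S \<in> apex_sets c P" for S
  proof
    assume v: "apex c P \<in> convex hull S"
    have "convex hull S \<subseteq> P"
      by (rule hull_minimal) (use that apex_set_subset convex in \<open>auto simp: apex_sets_def\<close>)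
    then have "apex c P extreme_point_of convex hull S"
      using apex_extreme[OF assms] v by (auto simp: extreme_point_of_def)
    then show "apex c P \<in> S" by (rule extreme_point_of_convex_hull)
  qed (rule hull_inc)
  show ?thesis
    using simplex mem by (auto simp: apex_simplexes_def pointed_triangulation_eq)
qed

lemma card_apex_simplexes:
  assumes "P \<noteq> {}"
  shows "card (apex_simplexes c P k) = card {S \<in> apex_sets c P. apex c P \<in> S \<and> card S = Suc k}"
  unfolding apex_simplexes_eq[OF assms]
  by (intro card_image inj_on_subset[OF inj_on_convex_hull_apex_sets]) auto

end

section \<open>Collecting simplexes by dimension\<close>

text \<open>With \<open>m = Suc n - k\<close> positive, the upper index \<open>m + k - 1\<close> is
  \<open>n\<close> whatever \<open>k\<close> is; for \<open>k > n\<close> both sides vanish.\<close>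

lemma simplex_number_diff: "simplex_number k (int (Suc n) - int k) = int (n choose k)"
proof (cases "k \<le> n")
  case True
  then have "nat (int (Suc n) - int k) + k - 1 = n" by linarith
  then show ?thesis using True by (simp add: simplex_number_def)
qed (simp add: simplex_number_def)

theorem theorem4p3:
  fixes P :: "'a::euclidean_space set" and c :: 'a and d n :: nat
  assumes "polytope P"
    and "aff_dim P = int d"
    and "separates_vertices c P"
  shows "polytope_number c P n =
    (\<Sum>k=0..d. int (card (apex_simplexes c P k)) * simplex_number k (int n - int k))"
proof (cases n)
  case 0
  then show ?thesis by (simp add: polytope_number.simps simplex_number_def)
next
  case (Suc m)
  interpret pointed_polytope c P using assms by unfold_locales
  have ne: "P \<noteq> {}" using assms(2) by auto
  let ?A = "{S \<in> apex_sets c P. apex c P \<in> S}"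
  have fin: "finite ?A" using finite_apex_sets by auto
  have card: "card S \<noteq> 0" "card S - 1 \<le> d" if "S \<in> ?A" for S
    using that apex_set_finite[of S] apex_set_card_le[of S] assms(2) by (auto simp: apex_sets_def)
  \<comment> \<open>The cone moves the sum to the sets containing the apex, where
    \<open>card S - 1\<close> is the dimension of the simplex.\<close>
  have "polytope_number c P n = (\<Sum>S\<in>?A. int (m choose (card S - 1)))"
    using polytope_numbers_eq_apex_sets_sums[OF pointed_polytope_axioms ne]
      sum_apex_sets_cone[OF ne, of "\<lambda>k. int (m choose (k - 1))"] Suc by simp
  also have "\<dots> = (\<Sum>k=0..d. \<Sum>S | S \<in> ?A \<and> card S - 1 = k. int (m choose (card S - 1)))"
    using fin card(2) by (intro sum.group[symmetric]) auto
  also have "\<dots> = (\<Sum>k=0..d. int (card (apex_simplexes c P k)) * int (m choose k))"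
  proof (rule sum.cong)
    fix k
    have "{S \<in> ?A. card S - 1 = k} = {S \<in> apex_sets c P. apex c P \<in> S \<and> card S = Suc k}"
      using card(1) by fastforce
    then show "(\<Sum>S | S \<in> ?A \<and> card S - 1 = k. int (m choose (card S - 1))) =
        int (card (apex_simplexes c P k)) * int (m choose k)"
      by (simp add: card_apex_simplexes[OF ne])
  qed simp
  finally show ?thesis by (simp only: Suc simplex_number_diff)
qed

end
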